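(* Let $d\ge 1$, let $\mathbf f$ be a $d\times d$ matrix-valued trigonometric polynomial with $\mathbf f(\theta)\ge 0$ for all $\theta$, and suppose that there exist unique $\theta_0\in[0,2\pi)$ and $\bar\jmath\in\{1,\dots,d\}$ such that $\lambda_{\bar\jmath}(\mathbf f(\theta_0))=0$ while $\lambda_j(\mathbf f(\theta))>0$ for every $(\theta,j)\ne(\theta_0,\bar\jmath)$, $\theta\in[0,2\pi)$. Let $q_{\bar\jmath}(\theta_0)$ be the eigenvector of $\mathbf f(\theta_0)$ with $\mathbf f(\theta_0)q_{\bar\jmath}(\theta_0)=0$. Let $\mathbf p$ be a $d\times d$ matrix-valued trigonometric polynomial such that $\mathbf p(\theta)^H\mathbf p(\theta)+\mathbf p(\theta+\pi)^H\mathbf p(\theta+\pi)>0$ for all $\theta\in[0,2\pi)$, and set $$\mathbf s(\theta)=\mathbf p(\theta)\left(\mathbf p(\theta)^H\mathbf p(\theta)+\mathbf p(\theta+\pi)^H\mathbf p(\theta+\pi)\right)^{-1}\mathbf p(\theta)^H .$$ Assume that 1. $\mathbf p(\theta_0)q_{\bar\jmath}(\theta_0)=\lambda^{(1)}_{\bar\jmath}q_{\bar\jmath}(\theta_0)$ for some $\lambda^{(1)}_{\bar\jmath}\ne0$; 2. $\mathbf p(\theta_0+\pi)q_{\bar\jmath}(\theta_0)=0$; 3. $\mathbf p(\theta_0)$ is non-singular. Then $\mathbf s(\theta_0)q_{\bar\jmath}(\theta_0)=q_{\bar\jmath}(\theta_0)$.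
   Context: A $d\times d$ matrix-valued trigonometric polynomial is a finite sum $\sum_j \hat{\mathbf f}_j e^{\iota j\theta}$ with $\hat{\mathbf f}_j\in\mathbb C^{d\times d}$, $\iota^2=-1$. $X^H$ is the conjugate transpose; $X\ge0$ (resp. $X>0$) means $X$ is Hermitian nonnegative (resp. positive) definite. $\lambda_1(\mathbf f(\theta)),\dots,\lambda_d(\mathbf f(\theta))$ denote the continuous eigenvalue functions of the Hermitian matrix-valued function $\mathbf f$. *)

theory Defs
  imports
    Complex_Main
    "Jordan_Normal_Form.Char_Poly"
    "Jordan_Normal_Form.Gauss_Jordan_Elimination"
    "Jordan_Normal_Form.Schur_Decomposition"
begin

text \<open>The coefficients and the finite frequency set do not depend on \<open>\<theta>\<close>; the sum of
  matrices is written entrywise, which keeps the dimension \<open>d\<close> also for an empty sum.\<close>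

definition matrix_trig_poly :: "nat \<Rightarrow> (real \<Rightarrow> complex mat) \<Rightarrow> bool" where
  "matrix_trig_poly d f \<longleftrightarrow>
     (\<exists>(J :: int set) (F :: int \<Rightarrow> complex mat).
        finite J \<and> (\<forall>j\<in>J. F j \<in> carrier_mat d d) \<and>
        (\<forall>\<theta>. f \<theta> = mat d d (\<lambda>(r, c). \<Sum>j\<in>J. F j $$ (r, c) * exp (\<i> * of_int j * of_real \<theta>))))"

definition hermitian_mat :: "complex mat \<Rightarrow> bool" where
  "hermitian_mat X \<longleftrightarrow> square_mat X \<and> mat_adjoint X = X"

text \<open>Since \<open>v \<bullet>c w\<close> conjugates \<open>w\<close>, the number \<open>(X *\<^sub>v v) \<bullet>c v\<close> is \<open>v\<^sup>H X v\<close>; it is real for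
  Hermitian \<open>X\<close>.\<close>

definition nonneg_def_mat :: "complex mat \<Rightarrow> bool" where
  "nonneg_def_mat X \<longleftrightarrow>
     hermitian_mat X \<and> (\<forall>v \<in> carrier_vec (dim_row X). 0 \<le> Re ((X *\<^sub>v v) \<bullet>c v))"

definition pos_def_mat :: "complex mat \<Rightarrow> bool" where
  "pos_def_mat X \<longleftrightarrow>
     hermitian_mat X \<and>
     (\<forall>v \<in> carrier_vec (dim_row X). v \<noteq> 0\<^sub>v (dim_row X) \<longrightarrow> 0 < Re ((X *\<^sub>v v) \<bullet>c v))"

text \<open>\<open>ev 1 \<theta>, \<dots>, ev d \<theta>\<close> are the eigenvalues of \<open>f \<theta>\<close> with their multiplicities. No order or
  periodicity of the labelling is assumed.\<close>

definition continuous_eigenvalue_functions ::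
    "nat \<Rightarrow> (real \<Rightarrow> complex mat) \<Rightarrow> (nat \<Rightarrow> real \<Rightarrow> real) \<Rightarrow> bool" where
  "continuous_eigenvalue_functions d f ev \<longleftrightarrow>
     (\<forall>j\<in>{1..d}. continuous_on UNIV (ev j)) \<and>
     (\<forall>\<theta>. char_poly (f \<theta>) = (\<Prod>j\<in>{1..d}. [:- complex_of_real (ev j \<theta>), 1:]))"

definition gram_sum :: "(real \<Rightarrow> complex mat) \<Rightarrow> real \<Rightarrow> complex mat" where
  "gram_sum p \<theta> =
     mat_adjoint (p \<theta>) * p \<theta> + mat_adjoint (p (\<theta> + pi)) * p (\<theta> + pi)"

text \<open>\<open>mat_inverse\<close> returns \<open>None\<close> exactly for non-invertible matrices, so \<open>the\<close> is harmless
  wherever \<open>gram_sum p \<theta>\<close> is positive definite.\<close>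

definition s_fun :: "(real \<Rightarrow> complex mat) \<Rightarrow> real \<Rightarrow> complex mat" where
  "s_fun p \<theta> = p \<theta> * the (mat_inverse (gram_sum p \<theta>)) * mat_adjoint (p \<theta>)"

end

theory Submission
  imports Defs
begin

text \<open>Since \<open>p (\<theta>\<^sub>0 + \<pi>)\<close> annihilates \<open>q\<close>, the Gram sum \<open>G\<close> at \<open>\<theta>\<^sub>0\<close> satisfies
  \<open>G q = P\<^sup>H P q = \<mu> P\<^sup>H q\<close> with \<open>P = p \<theta>\<^sub>0\<close>. Hence \<open>G\<^sup>-\<^sup>1 P\<^sup>H q = \<mu>\<^sup>-\<^sup>1 q\<close>, and applying \<open>P\<close>
  gives back \<open>q\<close>.\<close>

lemma mat_adjoint_carrier [simp]:
  "A \<in> carrier_mat n m \<Longrightarrow> mat_adjoint A \<in> carrier_mat m n"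
  by (auto simp: mat_adjoint_def carrier_matD)

text \<open>A nonzero \<open>v\<close> with \<open>A v = 0\<close> would give
  \<open>v^H A v = 0\<close>, against positive definiteness, so \<open>det A\<close> is nonzero.
  This makes \<open>the (mat_inverse A)\<close> a genuine inverse, which \<open>s_fun\<close> relies
  on.\<close>

lemma pos_def_mat_inverse_left:
  assumes A: "A \<in> carrier_mat n n" and pos: "pos_def_mat A"
  shows "the (mat_inverse A) \<in> carrier_mat n n" "the (mat_inverse A) * A = 1\<^sub>m n"
proof -
  have "det A \<noteq> 0"
  proof
    assume "det A = 0"
    then obtain v where v: "v \<in> carrier_vec n" "v \<noteq> 0\<^sub>v n" "A *\<^sub>v v = 0\<^sub>v n"
      using det_0_iff_vec_prod_zero[OF A] by blast
    have "(A *\<^sub>v v) \<bullet>c v = 0"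
      using v by simp
    with pos v A show False
      unfolding pos_def_mat_def by fastforce
  qed
  \<comment> \<open>The specification of \<open>mat_inverse\<close> speaks of units of the matrix
    ring; the \<open>()\<close> merely fills the extension slot of the ring record.\<close>
  then have "A \<in> Units (ring_mat TYPE(complex) n ())"
    by (rule det_non_zero_imp_unit[OF A])
  then obtain B where "mat_inverse A = Some B"
    using mat_inverse(1)[OF A, where b = "()"] by blast
  with mat_inverse(2)[OF A]
  show "the (mat_inverse A) \<in> carrier_mat n n" "the (mat_inverse A) * A = 1\<^sub>m n"
    by auto
qed

theorem lemma4p4:
  fixes d :: nat
    and f p :: "real \<Rightarrow> complex mat"
    and ev :: "nat \<Rightarrow> real \<Rightarrow> real"
    and \<theta>\<^sub>0 :: real
    and jbar :: nat
    and q :: "complex vec"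
    and \<mu> :: complex
  assumes d: "d \<ge> 1"
    and f_trig: "matrix_trig_poly d f"
    and f_nonneg: "\<And>\<theta>. nonneg_def_mat (f \<theta>)"
    and ev: "continuous_eigenvalue_functions d f ev"
    and theta0: "\<theta>\<^sub>0 \<in> {0..<2 * pi}"
    and jbar: "jbar \<in> {1..d}"
    and ev_zero: "ev jbar \<theta>\<^sub>0 = 0"
    and ev_pos: "\<And>\<theta> j. \<theta> \<in> {0..<2 * pi} \<Longrightarrow> j \<in> {1..d} \<Longrightarrow> (\<theta>, j) \<noteq> (\<theta>\<^sub>0, jbar)
                   \<Longrightarrow> ev j \<theta> > 0"
    and q: "eigenvector (f \<theta>\<^sub>0) q 0"
    and p_trig: "matrix_trig_poly d p"
    and p_pos: "\<And>\<theta>. \<theta> \<in> {0..<2 * pi} \<Longrightarrow> pos_def_mat (gram_sum p \<theta>)"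
    and eig: "p \<theta>\<^sub>0 *\<^sub>v q = \<mu> \<cdot>\<^sub>v q" "\<mu> \<noteq> 0"
    and shift: "p (\<theta>\<^sub>0 + pi) *\<^sub>v q = 0\<^sub>v d"
    and nonsing: "invertible_mat (p \<theta>\<^sub>0)"
  shows "s_fun p \<theta>\<^sub>0 *\<^sub>v q = q"
proof -
  let ?P = "p \<theta>\<^sub>0" and ?Q = "p (\<theta>\<^sub>0 + pi)" and ?G = "gram_sum p \<theta>\<^sub>0"
  let ?H = "mat_adjoint ?P" and ?I = "the (mat_inverse ?G)"
  have P: "?P \<in> carrier_mat d d" and Q: "?Q \<in> carrier_mat d d"
    using p_trig by (auto simp: matrix_trig_poly_def)
  have "f \<theta>\<^sub>0 \<in> carrier_mat d d"
    using f_trig by (auto simp: matrix_trig_poly_def)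
  with q have qd: "q \<in> carrier_vec d"
    by (auto simp: eigenvector_def)
  have H: "?H \<in> carrier_mat d d" and K: "mat_adjoint ?Q \<in> carrier_mat d d"
    using P Q by simp_all
  have G: "?G \<in> carrier_mat d d"
    unfolding gram_sum_def using mult_carrier_mat[OF H P] mult_carrier_mat[OF K Q] by simp
  note I = pos_def_mat_inverse_left[OF G p_pos[OF theta0]]
  have Hq: "?H *\<^sub>v q \<in> carrier_vec d"
    using H qd by simp
  have "?G *\<^sub>v q = ?H *\<^sub>v (?P *\<^sub>v q) + mat_adjoint ?Q *\<^sub>v (?Q *\<^sub>v q)"
    unfolding gram_sum_def
      add_mult_distrib_mat_vec[OF mult_carrier_mat[OF H P] mult_carrier_mat[OF K Q] qd]
      assoc_mult_mat_vec[OF H P qd] assoc_mult_mat_vec[OF K Q qd] ..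
  also have "\<dots> = \<mu> \<cdot>\<^sub>v (?H *\<^sub>v q)"
  proof -
    \<comment> \<open>By \<open>shift\<close> the second summand is \<open>mat_adjoint ?Q\<close>
      applied to the zero vector, so it vanishes; in the first, \<open>eig\<close> replaces
      \<open>?P q\<close> by a multiple of \<open>q\<close> and the scalar moves out.\<close>
    have "mat_adjoint ?Q *\<^sub>v 0\<^sub>v d = 0\<^sub>v d"
      using K by (intro eq_vecI) auto
    with Hq show ?thesis
      unfolding eig shift mult_mat_vec[OF H qd] by simp
  qed
  finally have Gq: "?G *\<^sub>v q = \<mu> \<cdot>\<^sub>v (?H *\<^sub>v q)" .
  \<comment> \<open>Computing \<open>?I (?G q)\<close> in two ways, by cancelling \<open>?G\<close>
    and by inserting \<open>Gq\<close>, determines \<open>?I (?H q)\<close> once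
    \<open>\<mu>\<close> is divided out.\<close>
  have "q = ?I *\<^sub>v (?G *\<^sub>v q)"
    using I G qd by (simp flip: assoc_mult_mat_vec[of _ d d _ d])
  also have "\<dots> = \<mu> \<cdot>\<^sub>v (?I *\<^sub>v (?H *\<^sub>v q))"
    unfolding Gq by (rule mult_mat_vec[OF I(1) Hq])
  finally have "inverse \<mu> \<cdot>\<^sub>v q = ?I *\<^sub>v (?H *\<^sub>v q)"
    using eig(2) by (metis left_inverse one_smult_vec smult_smult_assoc)
  then have "s_fun p \<theta>\<^sub>0 *\<^sub>v q = ?P *\<^sub>v (inverse \<mu> \<cdot>\<^sub>v q)"
    unfolding s_fun_def assoc_mult_mat_vec[OF mult_carrier_mat[OF P I(1)] H qd]
      assoc_mult_mat_vec[OF P I(1) Hq] by simp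
  \<comment> \<open>Second use of the eigenvector equation: \<open>?P\<close> multiplies
    \<open>q\<close> by \<open>\<mu>\<close>, which cancels the factor
    \<open>inverse \<mu>\<close>.\<close>
  also have "\<dots> = q"
    using P qd eig by (simp add: mult_mat_vec[of _ d d] smult_smult_assoc)
  finally show ?thesis .
qed

end
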